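(* Let $g:\mathbb{R}^m\to\overline{\mathbb{R}}$ be a polyhedral convex function and let $\mu>0$. Let $\bar w\in\mathbb{R}^m$ be given, admitting the decomposition $\bar w=\bar y+\mu\bar\lambda$ where $\bar y=\mathrm{prox}_{\mu g}(\bar w)$ and $\bar\lambda\in\partial g(\bar y)$. Then there exists a convex neighborhood $U$ of $\bar w$ such that for any $w\in U$, if $\nabla M^{\mu}_g$ is differentiable at $w$, then $$\nabla^2 M^{\mu}_g(w)\succeq \frac{1}{\mu}\bigl(I-\Pi_{\mathcal{S}(\bar y\mid\bar\lambda)}\bigr),$$ where $\mathcal{S}(\bar y\mid\bar\lambda)=T_g(\bar y\mid\bar\lambda)-T_g(\bar y\mid\bar\lambda)$ is the smallest subspace containing the cone $T_g(\bar y\mid\bar\lambda)$.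
   Context: $\overline{\mathbb{R}}=\mathbb{R}\cup\{\pm\infty\}$. A polyhedral convex function is a convex function whose epigraph is a polyhedral convex set (a finite intersection of closed half-spaces); equivalently it has the form $g(y)=\max_{1\le i\le p}\{a_i^\top y+b_i\}+\delta_{\mathcal{P}}(y)$ with $\mathcal{P}$ a polyhedral convex set and $\delta_{\mathcal P}$ its indicator function. For $\mu>0$, the Moreau envelope is $M^\mu_g(x)=\inf_y\{g(y)+\frac{1}{2\mu}\|y-x\|^2\}$ and $\mathrm{prox}_{\mu g}(x)=\arg\min_y\{g(y)+\frac{1}{2\mu}\|y-x\|^2\}$. $\partial g$ is the convex subdifferential, and $g'(y;w)$ is the one-sided directional derivative of $g$ at $y$ along $w$. For $\lambda\in\partial g(y)$, $T_g(y\mid\lambda):=\{w\mid g'(y;w)=\langle\lambda,w\rangle\}$, a convex cone; the difference $T-T$ denotes the set $\{a-b\mid a,b\in T\}$. $\Pi_{\mathcal{S}}$ denotes the Euclidean (orthogonal) projection onto $\mathcal{S}$, and for symmetric matrices $X\succeq Y$ means $X-Y$ is positive semidefinite. *)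

theory Defs
  imports "HOL-Analysis.Analysis"
begin

(* The library's epigraph and convex_on are for real-valued functions only. *)
definition ereal_epigraph :: "('a \<Rightarrow> ereal) \<Rightarrow> ('a \<times> real) set" where
  "ereal_epigraph g = {(x, t). g x \<le> ereal t}"

definition ereal_convex :: "('a::real_vector \<Rightarrow> ereal) \<Rightarrow> bool" where
  "ereal_convex g \<longleftrightarrow> convex (ereal_epigraph g)"

definition polyhedral_convex :: "('a::euclidean_space \<Rightarrow> ereal) \<Rightarrow> bool" where
  "polyhedral_convex g \<longleftrightarrow> ereal_convex g \<and> polyhedron (ereal_epigraph g)"

definition moreau_objective ::
    "real \<Rightarrow> ('a::euclidean_space \<Rightarrow> ereal) \<Rightarrow> 'a \<Rightarrow> 'a \<Rightarrow> ereal" where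
  "moreau_objective \<mu> g x y = g y + ereal (1 / (2 * \<mu>) * (norm (y - x))\<^sup>2)"

definition moreau_envelope ::
    "real \<Rightarrow> ('a::euclidean_space \<Rightarrow> ereal) \<Rightarrow> 'a \<Rightarrow> ereal" where
  "moreau_envelope \<mu> g x = (INF y. moreau_objective \<mu> g x y)"

(* The full set of minimizers; "y is the proximal point of x" is prox \<mu> g x = {y}. *)
definition prox :: "real \<Rightarrow> ('a::euclidean_space \<Rightarrow> ereal) \<Rightarrow> 'a \<Rightarrow> 'a set" where
  "prox \<mu> g x = {y. is_arg_min (moreau_objective \<mu> g x) (\<lambda>_. True) y}"

(* Empty where g is infinite; in particular a point of the subdifferential witnesses that a
   polyhedral convex g is proper, since its epigraph is then closed and contains no
   downward vertical line. *)
definition subdifferential :: "('a::euclidean_space \<Rightarrow> ereal) \<Rightarrow> 'a \<Rightarrow> 'a set" where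
  "subdifferential g y =
     {v. \<bar>g y\<bar> \<noteq> \<infinity> \<and> (\<forall>z. g y + ereal (v \<bullet> (z - y)) \<le> g z)}"

(* Taken in the extended reals: the value is \<infinity> along directions leaving the domain of g. *)
definition dir_deriv :: "('a::euclidean_space \<Rightarrow> ereal) \<Rightarrow> 'a \<Rightarrow> 'a \<Rightarrow> ereal" where
  "dir_deriv g y w = Lim (at_right 0) (\<lambda>t. (g (y + t *\<^sub>R w) - g y) / ereal t)"

definition crit_cone :: "('a::euclidean_space \<Rightarrow> ereal) \<Rightarrow> 'a \<Rightarrow> 'a \<Rightarrow> 'a set" where
  "crit_cone g y v = {w. dir_deriv g y w = ereal (v \<bullet> w)}"

definition crit_space :: "('a::euclidean_space \<Rightarrow> ereal) \<Rightarrow> 'a \<Rightarrow> 'a \<Rightarrow> 'a set" where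
  "crit_space g y v = {a - b | a b. a \<in> crit_cone g y v \<and> b \<in> crit_cone g y v}"

definition gradient :: "('a::euclidean_space \<Rightarrow> real) \<Rightarrow> 'a \<Rightarrow> 'a" where
  "gradient f x = (THE D. GDERIV f x :> D)"

definition hessian :: "(real ^ 'n \<Rightarrow> real) \<Rightarrow> real ^ 'n \<Rightarrow> real ^ 'n ^ 'n" where
  "hessian f x = jacobian (gradient f) (at x)"

definition proj_matrix :: "(real ^ 'n) set \<Rightarrow> real ^ 'n ^ 'n" where
  "proj_matrix S = matrix (closest_point S)"

definition loewner_ge :: "real ^ 'n ^ 'n \<Rightarrow> real ^ 'n ^ 'n \<Rightarrow> bool" (infix \<open>\<succeq>\<^sub>L\<close> 50) where
  "X \<succeq>\<^sub>L Y \<longleftrightarrow>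
     transpose X = X \<and> transpose Y = Y \<and> (\<forall>v. 0 \<le> v \<bullet> ((X - Y) *v v))"

end

theory Submission
  imports Defs
begin

text \<open>
  Write \<open>P\<close> for the proximal map and \<open>V x = (x - P x) / \<mu>\<close>.  By the optimality condition,
  \<open>P x\<close> is the unique point \<open>p\<close> with \<open>(x - p) / \<mu> \<in> \<partial>g(p)\<close>, so that \<open>P\<close> is firmly nonexpansive by
  monotonicity of the subdifferential, and the gradient of the Moreau envelope is \<open>V\<close>.  Wherever
  the gradient is differentiable, the Hessian is therefore \<open>(I - D) / \<mu>\<close> with \<open>D\<close> the derivative
  of \<open>P\<close>, and the claim is \<open>D \<le> \<Pi>\<close> for the orthogonal projection \<open>\<Pi>\<close> onto the critical space \<open>S\<close>.

  This bound follows from two properties of \<open>D\<close> alone.  Firm nonexpansiveness passes to the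
  derivative: \<open>|D h|\<^sup>2 \<le> \<langle>D h, h\<rangle>\<close>.  Also, near the base point \<open>w\<close> the proximal points stay in
  \<open>y + S\<close>, so \<open>D\<close> has its range in the closed subspace \<open>S\<close>.  Then \<open>\<langle>D h, h\<rangle> = \<langle>D h, \<Pi> h\<rangle>\<close>, so
  \<open>|D h|\<^sup>2 \<le> \<langle>D h, \<Pi> h\<rangle>\<close>, and hence \<open>\<langle>D h, h\<rangle> \<le> |\<Pi> h|\<^sup>2 = \<langle>\<Pi> h, h\<rangle>\<close>
  (\<open>inner_le_of_firm_and_orthogonal\<close>).

  Polyhedrality is used to keep the proximal points in \<open>y + S\<close>.  A polyhedral epigraph has only
  finitely many faces, so a point close to \<open>(y, g y)\<close> that minimizes a linear functional
  close to \<open>(-v, 1)\<close> over the epigraph also minimizes \<open>(-v, 1)\<close> itself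
  (\<open>polyhedron_minimizer_of_nearby_functional\<close>).  For \<open>x\<close> near \<open>w\<close> this says that the fixed
  subgradient \<open>v\<close> of \<open>g\<close> at \<open>y\<close> is also a subgradient at \<open>P x\<close>; then \<open>g\<close> is affine with slope
  \<open>v\<close> on the segment from \<open>y\<close> to \<open>P x\<close>, and \<open>P x - y\<close> lies in the critical cone.

  The Loewner order also demands that the Hessian be symmetric, which holds for the derivative of
  any gradient (\<open>symmetric_gradient_derivative\<close>).
\<close>

section \<open>Derivatives of gradients and directional quotients\<close>

text \<open>
  Both sides are the limit of the second difference of \<open>f\<close> over the parallelogram spanned by
  \<open>t a\<close> and \<open>t b\<close>, divided by \<open>t\<^sup>2\<close>, and that difference is symmetric in \<open>a\<close> and \<open>b\<close>.  As
  \<open>G\<close> is differentiable at \<open>w\<close> alone, the mean value theorem is applied to \<open>f\<close> and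
  the resulting increment of \<open>G\<close> is compared with its linearization at \<open>w\<close>.
\<close>
lemma symmetric_gradient_derivative:
  fixes f :: "'a::real_inner \<Rightarrow> real"
  assumes grad: "\<And>x. GDERIV f x :> G x" and A: "(G has_derivative A) (at w)"
  shows "A a \<bullet> b = A b \<bullet> a"
proof -
  interpret A: bounded_linear A by (rule has_derivative_bounded_linear[OF A])
  \<comment> \<open>The second difference over the parallelogram with sides \<open>t a\<close> and \<open>t b\<close>.\<close>
  define \<Delta> where "\<Delta> = (\<lambda>t a b. f (w + t *\<^sub>R a + t *\<^sub>R b) - f (w + t *\<^sub>R a) - f (w + t *\<^sub>R b) + f w)"
  have scale: "2 * (e / (2 * N\<^sup>2)) * (N * N) = e" if "N > 0" for e N :: real
    using that by (simp add: power2_eq_square)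
  have key: "\<exists>d>0. \<forall>t. 0 < t \<and> t < d \<longrightarrow> \<bar>\<Delta> t a b - t\<^sup>2 * (A b \<bullet> a)\<bar> \<le> t\<^sup>2 * e"
    if "e > 0" for e and a b :: 'a
  proof -
    \<comment> \<open>The tolerance for the linearization of \<open>G\<close>, small enough that two such errors cost at most \<open>t\<^sup>2 e\<close>.\<close>
    define k where "k = e / (2 * (norm a + norm b + 1)^2)"
    have nn: "norm a + norm b + 1 > 0" by (simp add: add_nonneg_pos)
    have "k > 0" using that nn by (simp add: k_def)
    then obtain d where d: "d > 0"
      and "\<forall>y. norm (y - w) < d \<longrightarrow> norm (G y - G w - A (y - w)) \<le> k * norm (y - w)"
      using A unfolding has_derivative_at_alt by blast
    then have bd: "norm (G (w + h) - G w - A h) \<le> k * norm h" if "norm h < d" for h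
      using that by (metis add_diff_cancel_left')
    have bd': "norm (G (w + s *\<^sub>R a + t *\<^sub>R b') - G w - A (s *\<^sub>R a + t *\<^sub>R b')) \<le> k * (T * (norm a + norm b + 1))"
      if "0 \<le> s" "s \<le> T" "0 \<le> t" "t \<le> T" "T < d / (norm a + norm b + 1)" "b' = b" for s t T b'
    proof -
      have "norm (s *\<^sub>R a + t *\<^sub>R b) \<le> s * norm a + t * norm b"
        by (rule order_trans[OF norm_triangle_ineq]) (use that in simp)
      also have "\<dots> \<le> T * norm a + T * norm b"
        using that by (intro add_mono mult_right_mono) auto
      also have "\<dots> \<le> T * (norm a + norm b + 1)" using that by (simp add: algebra_simps)
      finally have n: "norm (s *\<^sub>R a + t *\<^sub>R b) \<le> T * (norm a + norm b + 1)" .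
      also have "\<dots> < d" using that nn by (simp add: field_simps)
      finally have "norm (G (w + (s *\<^sub>R a + t *\<^sub>R b)) - G w - A (s *\<^sub>R a + t *\<^sub>R b)) \<le> k * norm (s *\<^sub>R a + t *\<^sub>R b)"
        by (rule bd)
      also have "\<dots> \<le> k * (T * (norm a + norm b + 1))"
        using n \<open>k > 0\<close> by (intro mult_left_mono) auto
      finally show ?thesis using that by (simp add: add.assoc)
    qed
    \<comment> \<open>The mean value theorem is applied along \<open>a\<close> to the increment of \<open>f\<close> along \<open>t b\<close>.\<close>
    have "\<bar>\<Delta> t a b - t\<^sup>2 * (A b \<bullet> a)\<bar> \<le> t\<^sup>2 * e"
      if t: "0 < t" "t < d / (norm a + norm b + 1)" for t
    proof -
      define \<phi> where "\<phi> = (\<lambda>s. f (w + s *\<^sub>R a + t *\<^sub>R b) - f (w + s *\<^sub>R a))"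
      define \<phi>' where "\<phi>' = (\<lambda>s. a \<bullet> (G (w + s *\<^sub>R a + t *\<^sub>R b) - G (w + s *\<^sub>R a)))"
      have line: "((\<lambda>s. f (c + s *\<^sub>R a)) has_real_derivative (a \<bullet> G (c + s *\<^sub>R a))) (at s)" for c s
      proof -
        have "(f has_derivative (\<lambda>h. h \<bullet> G (c + s *\<^sub>R a))) (at (c + s *\<^sub>R a))"
          using grad by (simp add: gderiv_def)
        then have "((\<lambda>s. f (c + s *\<^sub>R a)) has_derivative (\<lambda>h. (h *\<^sub>R a) \<bullet> G (c + s *\<^sub>R a))) (at s)"
          by (rule has_derivative_compose[rotated]) (auto intro!: derivative_eq_intros)
        then show ?thesis
          by (simp add: has_field_derivative_def mult_commute_abs)
      qed
      have "(\<phi> has_real_derivative \<phi>' s) (at s)" for s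
        using DERIV_diff[OF line[of "w + t *\<^sub>R b" s] line[of w s]]
        by (simp add: \<phi>_def \<phi>'_def algebra_simps)
      then obtain s where s: "0 < s" "s < t" and mv: "\<phi> t - \<phi> 0 = (t - 0) * \<phi>' s"
        using MVT2[of 0 t \<phi> \<phi>'] t by auto
      have "\<Delta> t a b = t * \<phi>' s" using mv by (simp add: \<Delta>_def \<phi>_def)
      then have "\<Delta> t a b - t\<^sup>2 * (A b \<bullet> a) = t * (\<phi>' s - t * (A b \<bullet> a))"
        by (simp add: power2_eq_square right_diff_distrib)
      then have "\<bar>\<Delta> t a b - t\<^sup>2 * (A b \<bullet> a)\<bar> = t * \<bar>\<phi>' s - t * (A b \<bullet> a)\<bar>"
        using t by (simp add: abs_mult)
      also have "\<phi>' s - t * (A b \<bullet> a) =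
          a \<bullet> ((G (w + s *\<^sub>R a + t *\<^sub>R b) - G w - A (s *\<^sub>R a + t *\<^sub>R b))
             - (G (w + s *\<^sub>R a + 0 *\<^sub>R b) - G w - A (s *\<^sub>R a + 0 *\<^sub>R b)))"
        by (simp add: \<phi>'_def A.add A.scaleR inner_diff_right inner_add_right inner_commute)
      also have "\<bar>\<dots>\<bar> \<le> norm a * (k * (t * (norm a + norm b + 1)) + k * (t * (norm a + norm b + 1)))"
        by (rule order_trans[OF Cauchy_Schwarz_ineq2], rule mult_left_mono,
            rule order_trans[OF norm_triangle_ineq4], rule add_mono)
          (use s t bd'[of s t t b] bd'[of s t 0 b] in simp_all)
      also have "\<dots> = t * (2 * k * (norm a * (norm a + norm b + 1)))" by (simp add: algebra_simps)
      also have "\<dots> \<le> t * (2 * k * ((norm a + norm b + 1) * (norm a + norm b + 1)))"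
        using t \<open>k > 0\<close> nn by (intro mult_left_mono mult_right_mono) auto
      also have "2 * k * ((norm a + norm b + 1) * (norm a + norm b + 1)) = e"
        using scale[OF nn] by (simp only: k_def)
      finally show ?thesis using t by (simp add: power2_eq_square mult.assoc)
    qed
    moreover have "d / (norm a + norm b + 1) > 0" using d nn by simp
    ultimately show ?thesis by blast
  qed
  have "\<bar>A a \<bullet> b - A b \<bullet> a\<bar> \<le> 0 + e" if e: "e > 0" for e
  proof -
    obtain d1 where d1: "d1 > 0" "\<And>t. 0 < t \<and> t < d1 \<Longrightarrow> \<bar>\<Delta> t a b - t\<^sup>2 * (A b \<bullet> a)\<bar> \<le> t\<^sup>2 * (e/2)"
      using key[of "e/2" a b] e by auto
    obtain d2 where d2: "d2 > 0" "\<And>t. 0 < t \<and> t < d2 \<Longrightarrow> \<bar>\<Delta> t b a - t\<^sup>2 * (A a \<bullet> b)\<bar> \<le> t\<^sup>2 * (e/2)"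
      using key[of "e/2" b a] e by auto
    define t where "t = min d1 d2 / 2"
    have t: "0 < t" "t < d1" "t < d2" using d1 d2 by (auto simp: t_def)
    have "\<Delta> t a b = \<Delta> t b a" by (simp add: \<Delta>_def algebra_simps)
    then have "\<bar>t\<^sup>2 * (A a \<bullet> b) - t\<^sup>2 * (A b \<bullet> a)\<bar> \<le> t\<^sup>2 * e"
      using d1(2)[of t] d2(2)[of t] t by (simp, linarith)
    then have "t\<^sup>2 * \<bar>A a \<bullet> b - A b \<bullet> a\<bar> \<le> t\<^sup>2 * e"
      by (simp add: abs_mult flip: right_diff_distrib)
    then show ?thesis using t by simp
  qed
  then show ?thesis using field_le_epsilon[of "\<bar>A a \<bullet> b - A b \<bullet> a\<bar>" 0] by force
qed

lemma tendsto_directional_quotient: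
  fixes f :: "'a::real_normed_vector \<Rightarrow> 'b::real_normed_vector"
  assumes "(f has_derivative D) (at x)"
  shows "((\<lambda>t. (1 / t) *\<^sub>R (f (x + t *\<^sub>R h) - f x)) \<longlongrightarrow> D h) (at_right 0)"
proof -
  interpret D: bounded_linear D by (rule has_derivative_bounded_linear[OF assms])
  have "((\<lambda>t. x + t *\<^sub>R h) has_derivative (\<lambda>t. t *\<^sub>R h)) (at 0)"
    by (auto intro!: derivative_eq_intros)
  moreover have "(f has_derivative D) (at (x + 0 *\<^sub>R h))" using assms by simp
  ultimately have "((\<lambda>t. f (x + t *\<^sub>R h)) has_derivative (\<lambda>t. D (t *\<^sub>R h))) (at 0)"
    by (rule has_derivative_compose)
  then have "((\<lambda>t. norm (f (x + t *\<^sub>R h) - f x - t *\<^sub>R D h) / norm t) \<longlongrightarrow> 0) (at 0)"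
    by (simp add: has_derivative_iff_norm D.scaleR)
  then have "((\<lambda>t. norm (f (x + t *\<^sub>R h) - f x - t *\<^sub>R D h) / norm t) \<longlongrightarrow> 0) (at_right 0)"
    by (rule filterlim_mono) (auto simp: at_le)
  moreover have "\<forall>\<^sub>F t in at_right 0. norm (f (x + t *\<^sub>R h) - f x - t *\<^sub>R D h) / norm t
      = norm ((1 / t) *\<^sub>R (f (x + t *\<^sub>R h) - f x) - D h)"
    using eventually_at_right_less[of "0::real"]
  proof eventually_elim
    case (elim t)
    then have "(1 / t) *\<^sub>R (f (x + t *\<^sub>R h) - f x) - D h
        = (1 / t) *\<^sub>R (f (x + t *\<^sub>R h) - f x - t *\<^sub>R D h)"
      by (simp add: scaleR_diff_right)
    then show ?case using elim by simp
  qed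
  ultimately have "((\<lambda>t. norm ((1 / t) *\<^sub>R (f (x + t *\<^sub>R h) - f x) - D h)) \<longlongrightarrow> 0) (at_right 0)"
    by (rule Lim_transform_eventually)
  then show ?thesis
    by (simp add: tendsto_norm_zero_iff LIM_zero_cancel)
qed

lemma derivative_firmly_nonexpansive:
  fixes f :: "'a::real_inner \<Rightarrow> 'a"
  assumes D: "(f has_derivative D) (at x)"
    and firm: "\<And>y. (f y - f x) \<bullet> (f y - f x) \<le> (f y - f x) \<bullet> (y - x)"
  shows "D h \<bullet> D h \<le> D h \<bullet> h"
proof (rule tendsto_le)
  let ?q = "\<lambda>t. (1 / t) *\<^sub>R (f (x + t *\<^sub>R h) - f x)"
  show "((\<lambda>t. ?q t \<bullet> h) \<longlongrightarrow> D h \<bullet> h) (at_right 0)"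
    and "((\<lambda>t. ?q t \<bullet> ?q t) \<longlongrightarrow> D h \<bullet> D h) (at_right 0)"
    by (intro tendsto_inner tendsto_directional_quotient[OF D] tendsto_const)+
  show "\<forall>\<^sub>F t in at_right 0. ?q t \<bullet> ?q t \<le> ?q t \<bullet> h"
    using eventually_at_right_less[of "0::real"]
  proof eventually_elim
    case (elim t)
    define u where "u = f (x + t *\<^sub>R h) - f x"
    have "u \<bullet> u \<le> t * (u \<bullet> h)" using firm[of "x + t *\<^sub>R h"] by (simp add: u_def)
    then have "u \<bullet> u / t\<^sup>2 \<le> t * (u \<bullet> h) / t\<^sup>2" by (rule divide_right_mono) simp
    then show ?case using elim by (simp add: power2_eq_square flip: u_def)
  qed
qed simp

lemma derivative_in_subspace:
  fixes f :: "'a::euclidean_space \<Rightarrow> 'b::euclidean_space"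
  assumes D: "(f has_derivative D) (at x)" and S: "subspace S"
    and near: "\<forall>\<^sub>F y in nhds x. f y - c \<in> S"
  shows "D h \<in> S"
proof (rule Lim_in_closed_set[OF closed_subspace[OF S]])
  show "((\<lambda>t. (1 / t) *\<^sub>R (f (x + t *\<^sub>R h) - f x)) \<longlongrightarrow> D h) (at_right 0)"
    by (rule tendsto_directional_quotient[OF D])
  have "((\<lambda>t. x + t *\<^sub>R h) \<longlongrightarrow> x) (at_right 0)"
    by (auto intro!: tendsto_eq_intros)
  from eventually_compose_filterlim[OF near this]
  show "\<forall>\<^sub>F t in at_right 0. (1 / t) *\<^sub>R (f (x + t *\<^sub>R h) - f x) \<in> S"
  proof eventually_elim
    case (elim t)
    have "(f (x + t *\<^sub>R h) - c) - (f x - c) \<in> S"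
      by (rule subspace_diff[OF S elim eventually_nhds_x_imp_x[OF near]])
    then show ?case by (intro subspace_scale[OF S]) simp
  qed
qed simp

section \<open>Orthogonal projection onto a subspace\<close>

lemma norm_add_sq: "(norm (a + b))\<^sup>2 = (norm a)\<^sup>2 + 2 * (a \<bullet> b) + (norm (b::'a::real_inner))\<^sup>2"
  by (simp add: power2_norm_eq_inner inner_add_left inner_add_right inner_commute)

lemma closest_point_subspace_unique:
  fixes S :: "'a::euclidean_space set"
  assumes S: "subspace S" and a: "a \<in> S" and orth: "\<And>s. s \<in> S \<Longrightarrow> (v - a) \<bullet> s = 0"
  shows "closest_point S v = a"
proof -
  have "dist v a \<le> dist v z" if "z \<in> S" for z
  proof -
    have "(norm (v - z))\<^sup>2 = (norm ((v - a) + (a - z)))\<^sup>2" by simp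
    also have "\<dots> = (norm (v - a))\<^sup>2 + (norm (a - z))\<^sup>2"
      unfolding norm_add_sq using orth[OF subspace_diff[OF S a that]] by simp
    finally have "(norm (v - a))\<^sup>2 \<le> (norm (v - z))\<^sup>2" by simp
    then show ?thesis by (simp add: dist_norm power2_le_iff_abs_le)
  qed
  then show ?thesis
    using closest_point_unique[OF subspace_imp_convex[OF S] closed_subspace[OF S] a, of v] by metis
qed

lemma closest_point_subspace:
  fixes S :: "'a::euclidean_space set"
  assumes S: "subspace S"
  shows "closest_point S v \<in> S" and "s \<in> S \<Longrightarrow> (v - closest_point S v) \<bullet> s = 0"
proof -
  obtain y z where y: "y \<in> span S" and z: "\<And>w. w \<in> span S \<Longrightarrow> orthogonal z w" and v: "v = y + z"
    using orthogonal_subspace_decomp_exists[of S v] by blast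
  have "closest_point S v = y"
    by (rule closest_point_subspace_unique[OF S])
      (use y z v span_eq_iff[THEN iffD2, OF S] in \<open>auto simp: orthogonal_def\<close>)
  then show "closest_point S v \<in> S" and "s \<in> S \<Longrightarrow> (v - closest_point S v) \<bullet> s = 0"
    using y z v span_eq_iff[THEN iffD2, OF S] by (auto simp: orthogonal_def)
qed

lemma linear_closest_point_subspace:
  fixes S :: "'a::euclidean_space set"
  assumes S: "subspace S"
  shows "linear (closest_point S)"
proof (rule linearI)
  note cp = closest_point_subspace[OF S]
  show "closest_point S (x + y) = closest_point S x + closest_point S y" for x y
  proof (rule closest_point_subspace_unique[OF S subspace_add[OF S cp(1) cp(1)]])
    show "(x + y - (closest_point S x + closest_point S y)) \<bullet> s = 0" if "s \<in> S" for s
      using cp(2)[OF that, of x] cp(2)[OF that, of y] by (simp add: inner_diff_left inner_add_left)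
  qed
  show "closest_point S (r *\<^sub>R x) = r *\<^sub>R closest_point S x" for r x
  proof (rule closest_point_subspace_unique[OF S subspace_scale[OF S cp(1)]])
    show "(r *\<^sub>R x - r *\<^sub>R closest_point S x) \<bullet> s = 0" if "s \<in> S" for s
      using cp(2)[OF that, of x] by (simp flip: scaleR_diff_right)
  qed
qed

lemma closest_point_subspace_self_adjoint:
  fixes S :: "'a::euclidean_space set"
  assumes S: "subspace S"
  shows "closest_point S x \<bullet> y = x \<bullet> closest_point S y"
  using closest_point_subspace(2)[OF S closest_point_subspace(1)[OF S], of x y]
    closest_point_subspace(2)[OF S closest_point_subspace(1)[OF S], of y x]
  by (simp add: inner_diff_left) (metis inner_commute)

lemma transpose_eq_self_iff_self_adjoint:
  fixes A :: "real ^ 'n ^ 'n"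
  shows "transpose A = A \<longleftrightarrow> (\<forall>x y. (A *v x) \<bullet> y = x \<bullet> (A *v y))"
proof
  assume "\<forall>x y. (A *v x) \<bullet> y = x \<bullet> (A *v y)"
  then have "adjoint (\<lambda>x. A *v x) = (\<lambda>x. A *v x)" by (rule adjoint_unique)
  then show "transpose A = A" by (simp add: adjoint_matrix matrix_eq fun_eq_iff)
next
  assume "transpose A = A"
  then show "\<forall>x y. (A *v x) \<bullet> y = x \<bullet> (A *v y)"
    by (metis dot_lmul_matrix vector_transpose_matrix)
qed

text \<open>
  Here \<open>a\<close> is the projection of \<open>a + b\<close> onto a subspace containing \<open>d\<close>.  Since
  \<open>d \<bullet> d \<le> d \<bullet> a\<close>, expanding \<open>0 \<le> (a - d) \<bullet> (a - d)\<close> gives \<open>d \<bullet> a \<le> a \<bullet> a\<close>.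
\<close>
lemma inner_le_of_firm_and_orthogonal:
  assumes firm: "d \<bullet> d \<le> d \<bullet> (a + b)" and orth: "d \<bullet> b = 0" "a \<bullet> b = 0"
  shows "d \<bullet> (a + b) \<le> a \<bullet> (a + (b::'a::real_inner))"
proof -
  have "0 \<le> (a - d) \<bullet> (a - d)" by simp
  then show ?thesis using firm orth by (simp add: inner_diff_left inner_diff_right inner_add_right inner_commute)
qed

section \<open>Subgradients through the epigraph\<close>

lemma subdifferential_value:
  "v \<in> subdifferential g y \<Longrightarrow> g y = ereal (real_of_ereal (g y))"
  by (simp add: subdifferential_def ereal_real)

lemma subdifferentialD:
  assumes "v \<in> subdifferential g y" and "g z \<le> ereal r"
  shows "real_of_ereal (g y) + v \<bullet> (z - y) \<le> r"
proof -
  have "g y + ereal (v \<bullet> (z - y)) \<le> g z"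
    using assms(1) by (simp add: subdifferential_def)
  then have "g y + ereal (v \<bullet> (z - y)) \<le> ereal r"
    using assms(2) by (rule order_trans)
  then show ?thesis
    by (subst (asm) subdifferential_value[OF assms(1)]) simp
qed

lemma subdifferentialI:
  assumes c: "g y = ereal c" and le: "\<And>z r. g z \<le> ereal r \<Longrightarrow> c + v \<bullet> (z - y) \<le> r"
  shows "v \<in> subdifferential g y"
proof -
  have "g y + ereal (v \<bullet> (z - y)) \<le> g z" for z
  proof (cases "g z")
    case (real r)
    then show ?thesis using le[of z r] c by simp
  next
    case MInf
    then show ?thesis using le[of z "c + v \<bullet> (z - y) - 1"] by simp
  qed (use c in simp)
  then show ?thesis by (simp add: subdifferential_def c)
qed

lemma ereal_convexD:
  assumes "ereal_convex g" "g x \<le> ereal r" "g y \<le> ereal s" "0 \<le> t" "t \<le> 1"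
  shows "g ((1 - t) *\<^sub>R x + t *\<^sub>R y) \<le> ereal ((1 - t) * r + t * s)"
proof -
  have "(1 - t) *\<^sub>R (x, r) + t *\<^sub>R (y, s) \<in> ereal_epigraph g"
    using assms by (intro convexD) (auto simp: ereal_convex_def ereal_epigraph_def)
  then show ?thesis by (simp add: ereal_epigraph_def)
qed

lemma subdifferential_monotone:
  assumes "u \<in> subdifferential g x" "v \<in> subdifferential g y"
  shows "0 \<le> (u - v) \<bullet> (x - y)"
  using subdifferentialD[OF assms(1), of y "real_of_ereal (g y)"]
    subdifferentialD[OF assms(2), of x "real_of_ereal (g x)"]
    subdifferential_value[OF assms(1)] subdifferential_value[OF assms(2)]
  by (simp add: inner_diff_left inner_diff_right)

section \<open>The critical cone\<close>

text \<open>
  This turns order statements about extended-real quotients into membership in the epigraph, where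
  no infinite values occur.
\<close>
lemma difference_quotient_le_iff:
  assumes "g y = ereal c" and "t > 0"
  shows "(g (y + t *\<^sub>R w) - g y) / ereal t \<le> ereal s \<longleftrightarrow> g (y + t *\<^sub>R w) \<le> ereal (c + t * s)"
  using assms by (cases "g (y + t *\<^sub>R w)") (auto simp: field_simps)

lemma ereal_convex_chord:
  assumes "ereal_convex g" and y: "g y = ereal c" and T: "g (y + T *\<^sub>R w) \<le> ereal (c + T * s)"
    and t: "0 < t" "t \<le> T"
  shows "g (y + t *\<^sub>R w) \<le> ereal (c + t * s)"
proof -
  have "g ((1 - t / T) *\<^sub>R y + (t / T) *\<^sub>R (y + T *\<^sub>R w))
      \<le> ereal ((1 - t / T) * c + (t / T) * (c + T * s))"
    using assms by (intro ereal_convexD) auto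
  moreover have "(1 - t / T) *\<^sub>R y + (t / T) *\<^sub>R (y + T *\<^sub>R w) = y + t *\<^sub>R w"
    using t by (simp add: algebra_simps)
  moreover have "(1 - t / T) * c + (t / T) * (c + T * s) = c + t * s"
    using t by (simp add: field_simps)
  ultimately show ?thesis by simp
qed

text \<open>
  The difference quotients of a convex function decrease as the step shrinks, so the limit
  exists and is the infimum, also when infinite values occur.
\<close>
lemma dir_deriv_eq_INF:
  assumes conv: "ereal_convex g" and v: "v \<in> subdifferential g y"
  shows "dir_deriv g y w = (INF t\<in>{0<..}. (g (y + t *\<^sub>R w) - g y) / ereal t)" (is "_ = Inf (?q ` _)")
proof -
  define c where "c = real_of_ereal (g y)"
  have y: "g y = ereal c" using subdifferential_value[OF v] by (simp add: c_def)
  have mono: "?q t \<le> ?q T" if "0 < t" "t \<le> T" for t T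
  proof (rule ereal_le_real)
    fix s assume "?q T \<le> ereal s"
    then show "?q t \<le> ereal s"
      using that difference_quotient_le_iff[of g y, OF y] ereal_convex_chord[OF conv y _ that] by simp
  qed
  have "(?q \<longlongrightarrow> Inf (?q ` {0<..})) (at_right 0)"
  proof (rule order_tendstoI)
    fix a assume "a < Inf (?q ` {0<..})"
    then have "a < ?q t" if "0 < t" for t
      by (rule less_le_trans) (use that in \<open>auto intro: INF_lower\<close>)
    then show "\<forall>\<^sub>F t in at_right 0. a < ?q t"
      by (intro eventually_mono[OF eventually_at_right_less[of 0]]) blast
  next
    fix a assume "Inf (?q ` {0<..}) < a"
    then obtain T where T: "T > 0" "?q T < a" by (auto simp: INF_less_iff)
    have "\<forall>\<^sub>F t in at_right 0. t \<in> {0<..<T}"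
      using eventually_at_right_real[OF T(1)] .
    then show "\<forall>\<^sub>F t in at_right 0. ?q t < a"
      by eventually_elim (rule le_less_trans[OF mono T(2)], auto)
  qed
  then show ?thesis
    unfolding dir_deriv_def by (intro tendsto_Lim) auto
qed

text \<open>
  The subgradient inequality bounds every difference quotient below by \<open>v \<bullet> w\<close>; a direction is thus
  critical as soon as the quotients come arbitrarily close to this bound.
\<close>
lemma mem_crit_cone_iff:
  assumes conv: "ereal_convex g" and v: "v \<in> subdifferential g y"
  shows "w \<in> crit_cone g y v \<longleftrightarrow>
    (\<forall>e>0. \<exists>t>0. g (y + t *\<^sub>R w) \<le> ereal (real_of_ereal (g y) + t * (v \<bullet> w + e)))"
proof -
  define c where "c = real_of_ereal (g y)"
  have y: "g y = ereal c" using subdifferential_value[OF v] by (simp add: c_def)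
  define q where "q = (\<lambda>t. (g (y + t *\<^sub>R w) - g y) / ereal t)"
  have q: "q t \<le> ereal s \<longleftrightarrow> g (y + t *\<^sub>R w) \<le> ereal (c + t * s)" if "t > 0" for t s
    using difference_quotient_le_iff[of g y, OF y that] by (simp add: q_def)
  have lower: "ereal (v \<bullet> w) \<le> q t" if "t > 0" for t
  proof (rule ereal_le_real)
    fix s assume "q t \<le> ereal s"
    then have "c + v \<bullet> (y + t *\<^sub>R w - y) \<le> c + t * s"
      using subdifferentialD[OF v, of "y + t *\<^sub>R w"] q[OF that] c_def by blast
    then show "ereal (v \<bullet> w) \<le> ereal s" using that by simp
  qed
  have "w \<in> crit_cone g y v \<longleftrightarrow> Inf (q ` {0<..}) = ereal (v \<bullet> w)"
    by (simp add: crit_cone_def dir_deriv_eq_INF[OF conv v] q_def)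
  also have "\<dots> \<longleftrightarrow> (\<forall>e>0. \<exists>t>0. q t \<le> ereal (v \<bullet> w + e))"
  proof
    assume *: "Inf (q ` {0<..}) = ereal (v \<bullet> w)"
    show "\<forall>e>0. \<exists>t>0. q t \<le> ereal (v \<bullet> w + e)"
    proof (intro allI impI)
      fix e :: real assume "e > 0"
      then have "Inf (q ` {0<..}) < ereal (v \<bullet> w + e)" by (simp add: *)
      then show "\<exists>t>0. q t \<le> ereal (v \<bullet> w + e)" by (auto simp: INF_less_iff intro: less_imp_le)
    qed
  next
    assume *: "\<forall>e>0. \<exists>t>0. q t \<le> ereal (v \<bullet> w + e)"
    show "Inf (q ` {0<..}) = ereal (v \<bullet> w)"
    proof (rule antisym)
      show "Inf (q ` {0<..}) \<le> ereal (v \<bullet> w)"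
      proof (rule ereal_le_epsilon2)
        fix e :: real assume "0 < e"
        then obtain t where "t > 0" "q t \<le> ereal (v \<bullet> w + e)" using * by blast
        then have "Inf (q ` {0<..}) \<le> ereal (v \<bullet> w + e)"
          by (auto intro: INF_lower2[of t])
        then show "Inf (q ` {0<..}) \<le> ereal (v \<bullet> w) + ereal e" by simp
      qed
    qed (auto intro!: INF_greatest lower)
  qed
  finally show ?thesis by (simp add: q flip: c_def cong: conj_cong)
qed

text \<open>
  By the chord lemma both directions may be followed with a common step \<open>t\<close>; the midpoint of the
  two end points lies at step \<open>t / 2\<close> along the sum.
\<close>
lemma crit_cone_add:
  assumes conv: "ereal_convex g" and v: "v \<in> subdifferential g y"
    and a: "a \<in> crit_cone g y v" and b: "b \<in> crit_cone g y v"
  shows "a + b \<in> crit_cone g y v"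
  unfolding mem_crit_cone_iff[OF conv v]
proof (intro allI impI)
  fix e :: real assume e: "e > 0"
  define c where "c = real_of_ereal (g y)"
  have y: "g y = ereal c" using subdifferential_value[OF v] by (simp add: c_def)
  obtain T1 where T1: "T1 > 0" "g (y + T1 *\<^sub>R a) \<le> ereal (c + T1 * (v \<bullet> a + e/2))"
    using a e unfolding mem_crit_cone_iff[OF conv v] c_def by (meson half_gt_zero)
  obtain T2 where T2: "T2 > 0" "g (y + T2 *\<^sub>R b) \<le> ereal (c + T2 * (v \<bullet> b + e/2))"
    using b e unfolding mem_crit_cone_iff[OF conv v] c_def by (meson half_gt_zero)
  define t where "t = min T1 T2"
  have t: "0 < t" "t \<le> T1" "t \<le> T2" using T1 T2 by (auto simp: t_def)
  have "g ((1 - 1/2) *\<^sub>R (y + t *\<^sub>R a) + (1/2) *\<^sub>R (y + t *\<^sub>R b))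
      \<le> ereal ((1 - 1/2) * (c + t * (v \<bullet> a + e/2)) + (1/2) * (c + t * (v \<bullet> b + e/2)))"
    by (intro ereal_convexD conv ereal_convex_chord[OF conv y T1(2)] ereal_convex_chord[OF conv y T2(2)] t) auto
  also have "(1 - 1/2) *\<^sub>R (y + t *\<^sub>R a) + (1/2) *\<^sub>R (y + t *\<^sub>R b) = y + (t/2) *\<^sub>R (a + b)"
    by (simp add: algebra_simps flip: scaleR_add_left)
  also have "(1 - 1/2) * (c + t * (v \<bullet> a + e/2)) + (1/2) * (c + t * (v \<bullet> b + e/2))
      = c + (t/2) * (v \<bullet> (a + b) + e)"
    by (simp add: field_simps inner_add_right)
  finally show "\<exists>t>0. g (y + t *\<^sub>R (a + b)) \<le> ereal (real_of_ereal (g y) + t * (v \<bullet> (a + b) + e))"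
    using t by (intro exI[of _ "t/2"]) (simp add: c_def)
qed

lemma crit_cone_scaleR:
  assumes conv: "ereal_convex g" and v: "v \<in> subdifferential g y"
    and a: "a \<in> crit_cone g y v" and r: "r \<ge> 0"
  shows "r *\<^sub>R a \<in> crit_cone g y v"
  unfolding mem_crit_cone_iff[OF conv v]
proof (intro allI impI)
  fix e :: real assume e: "e > 0"
  define c where "c = real_of_ereal (g y)"
  have y: "g y = ereal c" using subdifferential_value[OF v] by (simp add: c_def)
  show "\<exists>t>0. g (y + t *\<^sub>R r *\<^sub>R a) \<le> ereal (real_of_ereal (g y) + t * (v \<bullet> r *\<^sub>R a + e))"
  proof (cases "r = 0")
    case True
    then show ?thesis using e y by (intro exI[of _ 1]) simp
  next
    case False
    then have "r > 0" using r by simp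
    then obtain T where T: "T > 0" "g (y + T *\<^sub>R a) \<le> ereal (c + T * (v \<bullet> a + e/r))"
      using a e unfolding mem_crit_cone_iff[OF conv v] c_def by (meson divide_pos_pos)
    then show ?thesis using \<open>r > 0\<close>
      by (intro exI[of _ "T/r"]) (simp add: c_def field_simps)
  qed
qed

lemma crit_space_eq_span:
  assumes conv: "ereal_convex g" and v: "v \<in> subdifferential g y"
  shows "crit_space g y v = span (crit_cone g y v)"
proof
  show "crit_space g y v \<subseteq> span (crit_cone g y v)"
    by (auto simp: crit_space_def intro: span_diff span_base)
  have 0: "0 \<in> crit_cone g y v"
    using subdifferential_value[OF v] unfolding mem_crit_cone_iff[OF conv v]
    by (metis add_cancel_left_right ereal_less_eq(3) inner_zero_right le_add_same_cancel1 less_eq_real_def mult_1 scaleR_zero_right zero_less_one)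
  have "x \<in> crit_space g y v" if "x \<in> crit_cone g y v" for x
    unfolding crit_space_def using that 0 by force
  moreover have "subspace (crit_space g y v)"
  proof (rule subspaceI)
    show "0 \<in> crit_space g y v" unfolding crit_space_def using 0 by force
  next
    fix p q assume "p \<in> crit_space g y v" "q \<in> crit_space g y v"
    then obtain a b a' b' where *: "p = a - b" "q = a' - b'"
      "a \<in> crit_cone g y v" "b \<in> crit_cone g y v" "a' \<in> crit_cone g y v" "b' \<in> crit_cone g y v"
      unfolding crit_space_def by blast
    have "p + q = (a + a') - (b + b')" by (simp add: *)
    then show "p + q \<in> crit_space g y v"
      unfolding crit_space_def using * crit_cone_add[OF conv v] by blast
  next
    fix r p assume "p \<in> crit_space g y v"
    then obtain a b where *: "p = a - b" "a \<in> crit_cone g y v" "b \<in> crit_cone g y v"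
      unfolding crit_space_def by blast
    show "r *\<^sub>R p \<in> crit_space g y v"
    proof (cases "r \<ge> 0")
      case True
      have "r *\<^sub>R p = r *\<^sub>R a - r *\<^sub>R b" by (simp add: * algebra_simps)
      then show ?thesis unfolding crit_space_def using * crit_cone_scaleR[OF conv v] True by blast
    next
      case False
      have "r *\<^sub>R p = (-r) *\<^sub>R b - (-r) *\<^sub>R a" by (simp add: * algebra_simps)
      moreover have "-r \<ge> 0" using False by simp
      ultimately show ?thesis unfolding crit_space_def
        using crit_cone_scaleR[OF conv v *(2), of "-r"] crit_cone_scaleR[OF conv v *(3), of "-r"] by blast
    qed
  qed
  ultimately show "span (crit_cone g y v) \<subseteq> crit_space g y v"
    by (intro span_minimal) auto
qed

text \<open>
  A common subgradient at both ends forces \<open>g\<close> to grow from \<open>y\<close> to \<open>z\<close> exactly at the rate \<open>v\<close>,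
  so the step \<open>t = 1\<close> already attains the critical slope.
\<close>
lemma common_subgradient_imp_mem_crit_cone:
  assumes conv: "ereal_convex g" and v: "v \<in> subdifferential g y" "v \<in> subdifferential g z"
  shows "z - y \<in> crit_cone g y v"
proof -
  have "real_of_ereal (g z) + v \<bullet> (y - z) \<le> real_of_ereal (g y)"
    using subdifferentialD[OF v(2), of y] subdifferential_value[OF v(1)] by simp
  then have "g z \<le> ereal (real_of_ereal (g y) + 1 * (v \<bullet> (z - y) + e))" if "e > 0" for e
    using that by (subst subdifferential_value[OF v(2)]) (simp add: inner_diff_right)
  then show ?thesis
    unfolding mem_crit_cone_iff[OF conv v(1)] by (intro allI impI exI[of _ 1]) auto
qed

section \<open>The proximal map and the gradient of the Moreau envelope\<close>

lemma le_of_le_add_small: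
  fixes a b c :: real
  assumes "\<And>t. 0 < t \<Longrightarrow> t \<le> 1 \<Longrightarrow> a \<le> b + t * c"
  shows "a \<le> b"
proof (rule tendsto_lowerbound)
  show "((\<lambda>t. b + t * c) \<longlongrightarrow> b) (at_right 0)"
    by (auto intro!: tendsto_eq_intros)
  have "\<forall>\<^sub>F t::real in at_right 0. t \<in> {0<..<1}"
    by (intro eventually_at_right_real) simp
  then show "\<forall>\<^sub>F t in at_right 0. a \<le> b + t * c"
    by eventually_elim (use assms in auto)
qed simp

text \<open>
  Optimality is phrased through the subdifferential, in the form in which the
  proximal point is used below; \<open>moreau_envelope_prox\<close> shows that it attains the infimum.
\<close>
definition prox_point :: "real \<Rightarrow> ('a::euclidean_space \<Rightarrow> ereal) \<Rightarrow> 'a \<Rightarrow> 'a" where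
  "prox_point \<mu> g x = (THE p. (1 / \<mu>) *\<^sub>R (x - p) \<in> subdifferential g p)"

text \<open>
  The point \<open>y0\<close> with its subgradient \<open>v0\<close> provides the affine minorant of \<open>g\<close>
  that makes the proximal objective coercive.
\<close>
locale proximal =
  fixes g :: "'a::euclidean_space \<Rightarrow> ereal" and \<mu> :: real and y0 v0 :: 'a
  assumes conv: "ereal_convex g" and closed_epi: "closed (ereal_epigraph g)"
    and v0: "v0 \<in> subdifferential g y0" and \<mu>: "\<mu> > 0"
begin

abbreviation "P \<equiv> prox_point \<mu> g"
abbreviation "V x \<equiv> (1 / \<mu>) *\<^sub>R (x - P x)"
abbreviation "M x \<equiv> real_of_ereal (moreau_envelope \<mu> g x)"

text \<open>
  Adding the affine minorant at \<open>y0\<close> to the quadratic term and completing the square shows that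
  the sublevel set of the proximal objective in the epigraph is compact, so a minimizer exists.
  Comparing it with points on the segment towards an arbitrary \<open>z\<close>, and letting the
  step \<open>t\<close> tend to zero, removes the quadratic remainder and leaves the subgradient inequality.
\<close>
lemma ex_prox_point: "\<exists>p. (1 / \<mu>) *\<^sub>R (x - p) \<in> subdifferential g p"
proof -
  define c0 where "c0 = real_of_ereal (g y0)"
  define obj where "obj = (\<lambda>(z, r). r + 1 / (2 * \<mu>) * (norm (z - x))\<^sup>2)"
  define A where "A = {zr \<in> ereal_epigraph g. obj zr \<le> obj (y0, c0)}"
  have cont: "continuous_on UNIV obj"
    unfolding obj_def case_prod_beta by (intro continuous_intros)
  have y0A: "(y0, c0) \<in> A"
    using subdifferential_value[OF v0] by (simp add: A_def ereal_epigraph_def c0_def)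
  \<comment> \<open>This radius comes from completing the square in the proximal objective.\<close>
  define R where "R = norm (y0 - x + \<mu> *\<^sub>R v0) + norm (x - \<mu> *\<^sub>R v0)"
  have "A \<subseteq> cball 0 R \<times> {c0 - norm v0 * (R + norm y0) .. obj (y0, c0)}"
  proof clarify
    fix z r assume zr: "(z, r) \<in> A"
    then have r: "c0 + v0 \<bullet> (z - y0) \<le> r"
      using subdifferentialD[OF v0] by (auto simp: A_def ereal_epigraph_def c0_def)
    have "r + 1 / (2 * \<mu>) * (norm (z - x))\<^sup>2 \<le> obj (y0, c0)"
      using zr by (simp add: A_def obj_def)
    moreover have "0 \<le> 1 / (2 * \<mu>) * (norm (z - x))\<^sup>2" using \<mu> by simp
    ultimately have r': "r \<le> obj (y0, c0)" by linarith
    have "v0 \<bullet> (z - y0) + 1 / (2 * \<mu>) * (norm (z - x))\<^sup>2 \<le> 1 / (2 * \<mu>) * (norm (y0 - x))\<^sup>2"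
      using zr r by (simp add: A_def obj_def)
    then have "2 * \<mu> * (v0 \<bullet> (z - y0)) + (norm (z - x))\<^sup>2 \<le> (norm (y0 - x))\<^sup>2"
      using \<mu> mult_left_mono[of _ _ "2 * \<mu>"] by (fastforce simp: distrib_left)
    then have "(norm (z - x + \<mu> *\<^sub>R v0))\<^sup>2 \<le> (norm (y0 - x + \<mu> *\<^sub>R v0))\<^sup>2"
      unfolding norm_add_sq by (simp add: algebra_simps inner_commute)
    then have "norm (z - x + \<mu> *\<^sub>R v0) \<le> norm (y0 - x + \<mu> *\<^sub>R v0)"
      by (simp add: power2_le_iff_abs_le)
    moreover have "norm z \<le> norm (z - x + \<mu> *\<^sub>R v0) + norm (x - \<mu> *\<^sub>R v0)"
      using norm_triangle_ineq[of "z - x + \<mu> *\<^sub>R v0" "x - \<mu> *\<^sub>R v0"] by simp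
    ultimately have z: "norm z \<le> R" by (simp add: R_def)
    have "\<bar>v0 \<bullet> (z - y0)\<bar> \<le> norm v0 * norm (z - y0)" by (rule Cauchy_Schwarz_ineq2)
    also have "\<dots> \<le> norm v0 * (R + norm y0)"
      using z norm_triangle_ineq4[of z y0] by (intro mult_left_mono) auto
    finally show "z \<in> cball 0 R \<and> r \<in> {c0 - norm v0 * (R + norm y0) .. obj (y0, c0)}"
      using r r' z by simp
  qed
  moreover have "compact (cball (0::'a) R \<times> {c0 - norm v0 * (R + norm y0) .. obj (y0, c0)})"
    by (intro compact_Times compact_cball compact_Icc)
  moreover have "closed A"
  proof -
    have "A = ereal_epigraph g \<inter> {zr. obj zr \<le> obj (y0, c0)}" by (auto simp: A_def)
    then show ?thesis
      using closed_epi cont by (auto intro!: closed_Int closed_Collect_le continuous_on_const)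
  qed
  ultimately have "compact A"
    by (metis compact_Int_closed inf.absorb_iff2)
  then obtain m where m: "m \<in> A" "\<forall>zr\<in>A. obj m \<le> obj zr"
    using continuous_attains_inf[of A obj] y0A continuous_on_subset[OF cont] by blast
  obtain p c where pc: "m = (p, c)" by force
  have p: "(p, c) \<in> ereal_epigraph g" using m pc by (simp add: A_def)
  have min: "obj (p, c) \<le> obj (z, r)" if "g z \<le> ereal r" for z r
    using m that unfolding pc A_def ereal_epigraph_def by force
  have gp: "g p = ereal c"
  proof (cases "g p")
    case (real c')
    then show ?thesis using min[of p c'] p by (simp add: obj_def ereal_epigraph_def)
  next
    case MInf
    then show ?thesis using min[of p "c - 1"] by (simp add: obj_def)
  qed (use p in \<open>simp add: ereal_epigraph_def\<close>)
  have "c + ((1 / \<mu>) *\<^sub>R (x - p)) \<bullet> (z - p) \<le> r" if zr: "g z \<le> ereal r" for z r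
  proof (rule le_of_le_add_small)
    fix t :: real assume t: "0 < t" "t \<le> 1"
    have "obj (p, c) \<le> obj ((1 - t) *\<^sub>R p + t *\<^sub>R z, (1 - t) * c + t * r)"
      using t zr gp by (intro min ereal_convexD[OF conv]) auto
    moreover have "(1 - t) *\<^sub>R p + t *\<^sub>R z - x = (p - x) + t *\<^sub>R (z - p)"
      by (simp add: algebra_simps)
    ultimately have "c + 1 / (2 * \<mu>) * (norm (p - x))\<^sup>2 \<le> (1 - t) * c + t * r
        + 1 / (2 * \<mu>) * ((norm (p - x))\<^sup>2 + 2 * (t * ((p - x) \<bullet> (z - p))) + t\<^sup>2 * (norm (z - p))\<^sup>2)"
      by (simp add: obj_def norm_add_sq power_mult_distrib)
    then have "t * (c + 1 / \<mu> * ((x - p) \<bullet> (z - p))) \<le> t * (r + t * (1 / (2 * \<mu>) * (norm (z - p))\<^sup>2))"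
      using \<mu> by (simp add: field_simps power2_eq_square inner_diff_left)
    then show "c + ((1 / \<mu>) *\<^sub>R (x - p)) \<bullet> (z - p) \<le> r + t * (1 / (2 * \<mu>) * (norm (z - p))\<^sup>2)"
      using t by simp
  qed
  then show ?thesis using gp by (blast intro: subdifferentialI)
qed

lemma prox_point_inverse_strongly_monotone:
  assumes "(1 / \<mu>) *\<^sub>R (x - p) \<in> subdifferential g p" "(1 / \<mu>) *\<^sub>R (y - q) \<in> subdifferential g q"
  shows "(p - q) \<bullet> (p - q) \<le> (p - q) \<bullet> (x - y)"
proof -
  have "0 \<le> (1 / \<mu>) * (((x - p) - (y - q)) \<bullet> (p - q))"
    using subdifferential_monotone[OF assms] by (simp flip: scaleR_diff_right)
  then have "0 \<le> ((x - p) - (y - q)) \<bullet> (p - q)"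
    using \<mu> by (simp add: zero_le_divide_iff)
  then show ?thesis by (simp add: inner_commute algebra_simps)
qed

lemma prox_point_unique:
  assumes "(1 / \<mu>) *\<^sub>R (x - p) \<in> subdifferential g p"
  shows "P x = p"
  unfolding prox_point_def
proof (rule the_equality)
  show "(1 / \<mu>) *\<^sub>R (x - p) \<in> subdifferential g p" by (rule assms)
next
  fix q assume "(1 / \<mu>) *\<^sub>R (x - q) \<in> subdifferential g q"
  from prox_point_inverse_strongly_monotone[OF assms this] show "q = p" 
    by (metis diff_self eq_iff_diff_eq_0 inner_gt_zero_iff inner_zero_right not_less)
qed

lemma prox_subgradient: "V x \<in> subdifferential g (P x)"
  using ex_prox_point[of x] prox_point_unique by metis

lemma firmly_nonexpansive: "(P x - P y) \<bullet> (P x - P y) \<le> (P x - P y) \<bullet> (x - y)"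
  by (rule prox_point_inverse_strongly_monotone[OF prox_subgradient prox_subgradient])

lemma nonexpansive: "norm (P x - P y) \<le> norm (x - y)"
proof -
  have "norm (P x - P y) * norm (P x - P y) \<le> norm (P x - P y) * norm (x - y)"
    using firmly_nonexpansive[of x y] norm_cauchy_schwarz[of "P x - P y" "x - y"]
    by (simp add: power2_norm_eq_inner flip: power2_eq_square)
  then show ?thesis by (cases "P x = P y") auto
qed

lemma continuous_prox_point: "(P \<longlongrightarrow> P x) (nhds x)"
proof -
  have "continuous_on UNIV P"
    using nonexpansive by (intro lipschitz_on_continuous_on[of 1] lipschitz_onI) (auto simp: dist_norm)
  then show ?thesis by (simp add: continuous_on_eq_continuous_at continuous_at tendsto_at_iff_tendsto_nhds)
qed

lemma moreau_envelope_prox: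
  "moreau_envelope \<mu> g x = ereal (real_of_ereal (g (P x)) + 1 / (2 * \<mu>) * (norm (P x - x))\<^sup>2)"
  (is "_ = ereal ?m")
  unfolding moreau_envelope_def
proof (rule antisym)
  have "moreau_objective \<mu> g x (P x) = ereal ?m"
    unfolding moreau_objective_def by (subst subdifferential_value[OF prox_subgradient]) simp
  then show "(INF y. moreau_objective \<mu> g x y) \<le> ereal ?m"
    by (metis INF_lower UNIV_I)
  show "ereal ?m \<le> (INF y. moreau_objective \<mu> g x y)"
  proof (rule INF_greatest)
    fix y
    have "ereal (real_of_ereal (g (P x)) + V x \<bullet> (y - P x)) \<le> g y"
    proof (rule ereal_le_real)
      show "ereal (real_of_ereal (g (P x)) + V x \<bullet> (y - P x)) \<le> ereal r" if "g y \<le> ereal r" for r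
        using subdifferentialD[OF prox_subgradient that] by simp
    qed
    moreover have "?m \<le> real_of_ereal (g (P x)) + V x \<bullet> (y - P x) + 1 / (2 * \<mu>) * (norm (y - x))\<^sup>2"
    proof -
      have "(norm (y - x))\<^sup>2 = (norm ((P x - x) + (y - P x)))\<^sup>2" by simp
      also have "\<dots> = (norm (P x - x))\<^sup>2 - 2 * ((x - P x) \<bullet> (y - P x)) + (norm (y - P x))\<^sup>2"
        unfolding norm_add_sq by (simp add: inner_diff_left)
      finally have "(norm (y - x))\<^sup>2 \<ge> (norm (P x - x))\<^sup>2 - 2 * ((x - P x) \<bullet> (y - P x))" by simp
      then have "(norm (P x - x))\<^sup>2 \<le> 2 * ((x - P x) \<bullet> (y - P x)) + (norm (y - x))\<^sup>2" by simp
      from mult_left_mono[OF this, of "1 / (2 * \<mu>)"] show ?thesis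
        using \<mu> by (simp add: add_divide_distrib)
    qed
    ultimately show "ereal ?m \<le> moreau_objective \<mu> g x y"
      unfolding moreau_objective_def by (cases "g y") auto
  qed
qed

text \<open>
  \<open>P x\<close> is a feasible competitor in the problem that defines the envelope at \<open>y\<close>.
\<close>
lemma moreau_envelope_upper: "M y \<le> M x + V x \<bullet> (y - x) + 1 / (2 * \<mu>) * (norm (y - x))\<^sup>2"
proof -
  have "moreau_envelope \<mu> g y \<le> moreau_objective \<mu> g y (P x)"
    unfolding moreau_envelope_def by (rule INF_lower) simp
  also have "\<dots> = ereal (real_of_ereal (g (P x)) + 1 / (2 * \<mu>) * (norm (P x - y))\<^sup>2)"
    unfolding moreau_objective_def by (subst subdifferential_value[OF prox_subgradient]) simp
  finally have "M y \<le> real_of_ereal (g (P x)) + 1 / (2 * \<mu>) * (norm (P x - y))\<^sup>2"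
    by (simp add: moreau_envelope_prox)
  also have "(norm (P x - y))\<^sup>2 = (norm ((P x - x) + (x - y)))\<^sup>2" by simp
  also have "\<dots> = (norm (P x - x))\<^sup>2 + 2 * ((x - P x) \<bullet> (y - x)) + (norm (y - x))\<^sup>2"
    unfolding norm_add_sq by (simp add: inner_diff_left inner_diff_right norm_minus_commute)
  finally show ?thesis
    by (simp add: moreau_envelope_prox add_divide_distrib)
qed

text \<open>
  Using the quadratic upper bound at \<open>x\<close>, and again with the roles of \<open>x\<close> and \<open>y\<close> exchanged,
  traps the increment of the envelope between two linear terms, whose slopes differ by a multiple of
  \<open>norm (y - x)\<close> because \<open>P\<close> is nonexpansive.
\<close>
lemma GDERIV_moreau_envelope: "GDERIV M x :> V x"
proof -
  have bound: "\<bar>M y - M x - (y - x) \<bullet> V x\<bar> \<le> 2 / \<mu> * (norm (y - x))\<^sup>2" for y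
  proof -
    define d where "d = (norm (y - x))\<^sup>2 / \<mu>"
    have d: "d \<ge> 0" using \<mu> by (simp add: d_def)
    have up: "M y - M x - V x \<bullet> (y - x) \<le> d / 2"
      using moreau_envelope_upper[of y x] by (simp add: d_def)
    have "M x - M y + V y \<bullet> (y - x) \<le> d / 2"
      using moreau_envelope_upper[of x y]
      by (simp add: d_def norm_minus_commute inner_diff_right algebra_simps)
    moreover have "V x \<bullet> (y - x) - V y \<bullet> (y - x) \<le> d"
    proof -
      have "V x \<bullet> (y - x) - V y \<bullet> (y - x) = 1 / \<mu> * ((P y - P x) \<bullet> (y - x) - (y - x) \<bullet> (y - x))"
        using \<mu> by (simp add: field_simps inner_diff_left)
      also have "(P y - P x) \<bullet> (y - x) - (y - x) \<bullet> (y - x) \<le> (norm (y - x))\<^sup>2"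
        using norm_cauchy_schwarz[of "P y - P x" "y - x"] nonexpansive[of y x]
          mult_right_mono[OF nonexpansive[of y x], of "norm (y - x)"]
        by (simp add: power2_eq_square) (smt (verit) inner_ge_zero)
      finally show ?thesis using \<mu> by (simp add: d_def field_simps)
    qed
    ultimately have "\<bar>M y - M x - V x \<bullet> (y - x)\<bar> \<le> 2 * d"
      using up d by linarith
    then show ?thesis by (simp add: d_def inner_commute)
  qed
  have "(M has_derivative (\<lambda>h. h \<bullet> V x)) (at x)"
    unfolding has_derivative_at_alt
  proof (intro conjI allI impI)
    show "bounded_linear (\<lambda>h. h \<bullet> V x)" by (rule bounded_linear_inner_left)
    fix e :: real assume "e > 0"
    have "norm (M y - M x - (y - x) \<bullet> V x) \<le> e * norm (y - x)" if "norm (y - x) < e * \<mu> / 2" for y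
    proof -
      have "2 / \<mu> * (norm (y - x))\<^sup>2 = (2 / \<mu> * norm (y - x)) * norm (y - x)"
        by (simp add: power2_eq_square)
      also have "\<dots> \<le> e * norm (y - x)"
        using that \<mu> by (intro mult_right_mono) (auto simp: field_simps)
      finally show ?thesis using bound[of y] by simp
    qed
    then show "\<exists>d>0. \<forall>y. norm (y - x) < d \<longrightarrow> norm (M y - M x - (y - x) \<bullet> V x) \<le> e * norm (y - x)"
      using \<open>e > 0\<close> \<mu> by (intro exI[of _ "e * \<mu> / 2"]) auto
  qed
  then show ?thesis by (simp add: gderiv_def)
qed

lemma gradient_moreau_envelope: "gradient (\<lambda>x. M x) = (\<lambda>x. V x)"
proof
  fix x
  show "gradient (\<lambda>x. M x) x = V x"
    unfolding gradient_def
  proof (rule the_equality)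
    show "GDERIV (\<lambda>x. M x) x :> V x" by (rule GDERIV_moreau_envelope)
  next
    fix D assume "GDERIV (\<lambda>x. M x) x :> D"
    then have "(\<lambda>h. h \<bullet> D) = (\<lambda>h. h \<bullet> V x)"
      using GDERIV_moreau_envelope[of x] unfolding gderiv_def by (rule has_derivative_unique)
    then have "\<forall>h. h \<bullet> D = h \<bullet> V x" by (rule fun_cong[THEN allI])
    then show "D = V x" by (simp only: vector_eq_ldot)
  qed
qed

end

section \<open>Rigidity of polyhedral subdifferentials\<close>

text \<open>
  The minimizers of a functional over \<open>E\<close> form a face.  For a face \<open>F\<close>, the set of pairs of a
  point of \<open>F\<close> and a functional minimized on all of \<open>F\<close> is closed, and these finitely many sets
  cover all pairs of a functional and a minimizer.  Near \<open>(z0, c0)\<close> only the sets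
  containing \<open>(z0, c0)\<close> matter, and for such a face \<open>c0\<close> is minimized on all of \<open>F\<close>.
\<close>
lemma polyhedron_minimizer_of_nearby_functional:
  fixes E :: "'a::euclidean_space set"
  assumes "polyhedron E"
  shows "\<forall>\<^sub>F zc in nhds (z0, c0). fst zc \<in> E \<and> (\<forall>x\<in>E. snd zc \<bullet> fst zc \<le> snd zc \<bullet> x)
           \<longrightarrow> (\<forall>x\<in>E. c0 \<bullet> fst zc \<le> c0 \<bullet> x)"
proof -
  define C where "C = (\<lambda>F. F \<times> {c. \<forall>x\<in>F. \<forall>x'\<in>E. c \<bullet> x \<le> c \<bullet> x'})"
  \<comment> \<open>The faces whose closed set misses the base pair; their union is avoided near it.\<close>
  define B where "B = {F. F face_of E \<and> (z0, c0) \<notin> C F}"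
  have "closed (C F)" if "F face_of E" for F
  proof -
    have "closed F"
      using that assms face_of_imp_closed polyhedron_imp_closed polyhedron_imp_convex by blast
    moreover have "{c. \<forall>x\<in>F. \<forall>x'\<in>E. c \<bullet> x \<le> c \<bullet> x'} = (\<Inter>x\<in>F. \<Inter>x'\<in>E. {c. c \<bullet> x \<le> c \<bullet> x'})"
      by blast
    ultimately show ?thesis
      unfolding C_def by (auto intro!: closed_Times closed_INT closed_Collect_le continuous_intros)
  qed
  moreover have "finite B"
    by (rule finite_subset[OF _ finite_polyhedron_faces[OF assms]]) (auto simp: B_def)
  ultimately have "open (- (\<Union>F\<in>B. C F))"
    by (intro open_Compl closed_UN) (auto simp: B_def)
  then have "\<forall>\<^sub>F zc in nhds (z0, c0). zc \<in> - (\<Union>F\<in>B. C F)"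
    by (rule eventually_nhds_in_open) (auto simp: B_def)
  then show ?thesis
  proof eventually_elim
    case (elim zc)
    obtain z c where zc: "zc = (z, c)" by force
    have "c0 \<bullet> z \<le> c0 \<bullet> x" if z: "z \<in> E" and min: "\<forall>x\<in>E. c \<bullet> z \<le> c \<bullet> x" and x: "x \<in> E" for x
    proof -
      \<comment> \<open>The exposed face of all minimizers of \<open>c\<close>.\<close>
      define F where "F = E \<inter> {x. c \<bullet> x = c \<bullet> z}"
      have "F face_of E"
        unfolding F_def using min assms
        by (intro face_of_Int_supporting_hyperplane_ge polyhedron_imp_convex) auto
      moreover have zF: "z \<in> F" using z by (simp add: F_def)
      moreover have "(z, c) \<in> C F" using z min by (auto simp: C_def F_def)
      ultimately have "(z0, c0) \<in> C F"
        using elim zc by (auto simp: B_def)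
      then show ?thesis using zF x by (auto simp: C_def)
    qed
    then show ?case by (simp add: zc)
  qed
qed

context proximal begin

text \<open>
  At the base point the proximal point is \<open>y0\<close> and the associated subgradient is \<open>v0\<close>.  Polyhedral
  rigidity applies to nearby points once \<open>(P x, g (P x))\<close> and \<open>V x\<close> are known to converge;
  convergence of the values holds although \<open>g\<close> need not be continuous, because the two subgradient
  inequalities between \<open>y0\<close> and \<open>P x\<close> squeeze \<open>g (P x)\<close>.
\<close>
lemma eventually_limit_subgradient_at_prox:
  assumes poly: "polyhedron (ereal_epigraph g)"
  shows "\<forall>\<^sub>F x in nhds (y0 + \<mu> *\<^sub>R v0). v0 \<in> subdifferential g (P x)"
proof -
  define w0 where "w0 = y0 + \<mu> *\<^sub>R v0"
  define c where "c = (\<lambda>x. real_of_ereal (g (P x)))"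
  have "P w0 = y0"
    by (rule prox_point_unique) (use v0 \<mu> in \<open>simp add: w0_def\<close>)
  then have P: "(P \<longlongrightarrow> y0) (nhds w0)"
    using continuous_prox_point[of w0] by simp
  have "((\<lambda>x. V x) \<longlongrightarrow> (1 / \<mu>) *\<^sub>R (w0 - y0)) (nhds w0)"
    by (intro tendsto_intros P filterlim_ident)
  then have V: "((\<lambda>x. V x) \<longlongrightarrow> v0) (nhds w0)"
    using \<mu> by (simp add: w0_def)
  define c0 where "c0 = real_of_ereal (g y0)"
  have "(c \<longlongrightarrow> c0) (nhds w0)"
  proof (rule tendsto_sandwich)
    show "\<forall>\<^sub>F x in nhds w0. c0 + v0 \<bullet> (P x - y0) \<le> c x"
      using subdifferentialD[OF v0] subdifferential_value[OF prox_subgradient]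
      by (simp add: c_def c0_def)
    show "\<forall>\<^sub>F x in nhds w0. c x \<le> c0 - V x \<bullet> (y0 - P x)"
      using subdifferentialD[OF prox_subgradient, of y0 c0] subdifferential_value[OF v0]
      by (simp add: c_def c0_def le_diff_eq)
    show "((\<lambda>x. c0 + v0 \<bullet> (P x - y0)) \<longlongrightarrow> c0) (nhds w0)"
      by (auto intro!: tendsto_eq_intros P)
    show "((\<lambda>x. c0 - V x \<bullet> (y0 - P x)) \<longlongrightarrow> c0) (nhds w0)"
      by (rule tendsto_eq_intros V P refl)+ simp
  qed
  with P V have "((\<lambda>x. ((P x, c x), (- V x, 1::real))) \<longlongrightarrow> ((y0, c0), (- v0, 1))) (nhds w0)"
    by (intro tendsto_intros)
  from eventually_compose_filterlim[OF polyhedron_minimizer_of_nearby_functional[OF poly] this]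
  have "\<forall>\<^sub>F x in nhds w0. v0 \<in> subdifferential g (P x)"
  proof eventually_elim
    case (elim x)
    have val: "g (P x) = ereal (c x)"
      unfolding c_def by (rule subdifferential_value[OF prox_subgradient])
    have "(P x, c x) \<in> ereal_epigraph g" by (simp add: ereal_epigraph_def val)
    moreover have "(- V x, 1) \<bullet> (P x, c x) \<le> (- V x, 1) \<bullet> zr" if "zr \<in> ereal_epigraph g" for zr
      using that subdifferentialD[OF prox_subgradient[of x], of "fst zr" "snd zr"]
      by (auto simp: ereal_epigraph_def inner_Pair c_def inner_diff_right)
    ultimately have *: "(- v0, 1) \<bullet> (P x, c x) \<le> (- v0, 1) \<bullet> zr" if "zr \<in> ereal_epigraph g" for zr
      using elim that by simp
    show ?case
    proof (rule subdifferentialI[of g, OF val])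
      fix z r assume "g z \<le> ereal r"
      then show "c x + v0 \<bullet> (z - P x) \<le> r"
        using *[of "(z, r)"] by (simp add: ereal_epigraph_def inner_Pair inner_diff_right)
    qed
  qed
  then show ?thesis by (simp add: w0_def)
qed

end

section \<open>The Hessian bound\<close>

theorem proposition6:
  fixes g :: "real ^ 'm \<Rightarrow> ereal"
    and \<mu> :: real
    and wbar ybar lambdabar :: "real ^ 'm"
  assumes "polyhedral_convex g"
    and "\<mu> > 0"
    and "wbar = ybar + \<mu> *\<^sub>R lambdabar"
    and "prox \<mu> g wbar = {ybar}"
    and "lambdabar \<in> subdifferential g ybar"
  defines "M \<equiv> \<lambda>x. real_of_ereal (moreau_envelope \<mu> g x)"
    and "S \<equiv> crit_space g ybar lambdabar"
  shows "S = span (crit_cone g ybar lambdabar) \<and>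
    (\<exists>U. convex U \<and> wbar \<in> interior U \<and>
      (\<forall>w\<in>U. gradient M differentiable (at w) \<longrightarrow>
         hessian M w \<succeq>\<^sub>L (1 / \<mu>) *\<^sub>R (mat 1 - proj_matrix S)))"
proof -
  have conv: "ereal_convex g" and poly: "polyhedron (ereal_epigraph g)"
    using assms(1) by (auto simp: polyhedral_convex_def)
  interpret proximal g \<mu> ybar lambdabar
    by standard (use conv poly polyhedron_imp_closed assms in auto)
  have S_eq: "S = span (crit_cone g ybar lambdabar)"
    unfolding S_def by (rule crit_space_eq_span[OF conv v0])
  then have S: "subspace S" by simp
  have "\<forall>\<^sub>F x in nhds wbar. P x - ybar \<in> S"
    using eventually_limit_subgradient_at_prox[OF poly] unfolding assms(3)
    by eventually_elim (auto simp: S_eq intro!: span_base common_subgradient_imp_mem_crit_cone conv v0)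
  then obtain e where e: "e > 0" and near: "\<And>x. x \<in> ball wbar e \<Longrightarrow> P x - ybar \<in> S"
    by (auto simp: eventually_nhds_metric dist_commute)
  have "hessian M w \<succeq>\<^sub>L (1 / \<mu>) *\<^sub>R (mat 1 - proj_matrix S)"
    if w: "w \<in> ball wbar e" and diff: "gradient M differentiable (at w)" for w
  proof -
    define H where "H = hessian M w"
    have grad: "gradient M = (\<lambda>x. V x)"
      unfolding M_def by (rule gradient_moreau_envelope)
    have H: "((\<lambda>x. V x) has_derivative (\<lambda>h. H *v h)) (at w)"
      using diff jacobian_works unfolding H_def hessian_def grad by blast
    have H_sym: "transpose H = H"
      using symmetric_gradient_derivative[OF GDERIV_moreau_envelope H]
      by (simp add: transpose_eq_self_iff_self_adjoint inner_commute)
    \<comment> \<open>Since \<open>P x = x - \<mu> V x\<close>, this is the derivative of the proximal map.\<close>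
    define D where "D = (\<lambda>h. h - \<mu> *\<^sub>R (H *v h))"
    have "((\<lambda>x. x - \<mu> *\<^sub>R V x) has_derivative D) (at w)"
      unfolding D_def by (intro derivative_intros H)
    then have D: "(P has_derivative D) (at w)" using \<mu> by simp
    have "\<forall>\<^sub>F x in nhds w. x \<in> ball wbar e"
      using w by (intro eventually_nhds_in_open) auto
    then have D_S: "D h \<in> S" for h
      by (intro derivative_in_subspace[OF D S, of ybar]) (rule eventually_mono[OF _ near])
    define Q where "Q = closest_point S"
    have proj: "proj_matrix S *v h = Q h" for h
      unfolding proj_matrix_def Q_def by (rule fun_cong[OF matrix_vector_mul(2)[OF linear_closest_point_subspace[OF S]]])
    have Y: "((1 / \<mu>) *\<^sub>R (mat 1 - proj_matrix S)) *v h = (1 / \<mu>) *\<^sub>R (h - Q h)" for h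
      by (simp add: matrix_vector_mult_diff_rdistrib proj flip: scaleR_matrix_vector_assoc)
    have "transpose ((1 / \<mu>) *\<^sub>R (mat 1 - proj_matrix S)) = (1 / \<mu>) *\<^sub>R (mat 1 - proj_matrix S)"
      unfolding transpose_eq_self_iff_self_adjoint Y
      using closest_point_subspace_self_adjoint[OF S]
      by (simp add: Q_def inner_diff_left inner_diff_right)
    moreover have "0 \<le> h \<bullet> ((H - (1 / \<mu>) *\<^sub>R (mat 1 - proj_matrix S)) *v h)" for h
    proof -
      have "D h \<bullet> (Q h + (h - Q h)) \<le> Q h \<bullet> (Q h + (h - Q h))"
        using derivative_firmly_nonexpansive[OF D firmly_nonexpansive, of h]
          closest_point_subspace[OF S] D_S
        by (intro inner_le_of_firm_and_orthogonal) (auto simp: Q_def inner_commute)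
      then have "0 \<le> (1 / \<mu>) * (h \<bullet> (Q h - D h))"
        using \<mu> by (simp add: inner_diff_right inner_commute)
      also have "Q h - D h = \<mu> *\<^sub>R (H *v h - (1 / \<mu>) *\<^sub>R (h - Q h))"
        using \<mu> by (simp add: D_def scaleR_diff_right)
      also have "(1 / \<mu>) * (h \<bullet> \<dots>) = h \<bullet> (H *v h - (1 / \<mu>) *\<^sub>R (h - Q h))"
        using \<mu> by simp
      finally show ?thesis by (simp add: matrix_vector_mult_diff_rdistrib Y)
    qed
    ultimately show ?thesis
      using H_sym by (simp add: loewner_ge_def H_def)
  qed
  then have "\<exists>U. convex U \<and> wbar \<in> interior U \<and>
      (\<forall>w\<in>U. gradient M differentiable (at w) \<longrightarrow>
         hessian M w \<succeq>\<^sub>L (1 / \<mu>) *\<^sub>R (mat 1 - proj_matrix S))"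
    using e by (intro exI[of _ "ball wbar e"]) (auto simp: interior_open)
  with S_eq show ?thesis by blast
qed

end
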